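(* Let $\mathbf{R}:\mathbb{R}^N\to\mathbb{R}^N$ be continuously differentiable and Lipschitz continuous with constant $\kappa>0$, i.e. $\|\mathbf{R}(\mathbf{x})-\mathbf{R}(\mathbf{y})\|_2\le\kappa\|\mathbf{x}-\mathbf{y}\|_2$ for all $\mathbf{x},\mathbf{y}\in\mathbb{R}^N$. Let $\mathbf{u}_F$, $\tilde{\mathbf{u}}_G$, $\tilde{\mathbf{u}}_A:[0,T]\to\mathbb{R}^N$ be the solutions of the full-order model, the Galerkin reduced-order model (ROM) and the Adjoint Petrov--Galerkin (APG) ROM, respectively: $$\frac{d\mathbf{u}_F}{dt}=\mathbf{R}(\mathbf{u}_F),\qquad \frac{d\tilde{\mathbf{u}}_G}{dt}=\mathbb{P}_G\mathbf{R}(\tilde{\mathbf{u}}_G),\qquad \frac{d\tilde{\mathbf{u}}_A}{dt}=\mathbb{P}_A\mathbf{R}(\tilde{\mathbf{u}}_A),\qquad \mathbf{u}_F(0)=\tilde{\mathbf{u}}_G(0)=\tilde{\mathbf{u}}_A(0)=\mathbf{u}_0,$$ where $\mathbb{P}_G=\tilde{\Pi}$ and $\mathbb{P}_A=\tilde{\Pi}\big[\mathbf{I}+\tau\mathbf{J}[\tilde{\mathbf{u}}_A]\Pi'\big]$, and assume that the matrix $\mathbb{P}_A$ is stationary in time (i.e. $\mathbb{P}_A$ evaluated along $\tilde{\mathbf{u}}_A(t)$ does not depend on $t$). Define the errors $\mathbf{e}_G=\mathbf{u}_F-\tilde{\mathbf{u}}_G$ and $\mathbf{e}_A=\mathbf{u}_F-\tilde{\mathbf{u}}_A$.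 Then for all $t\in[0,T]$, $$\|\mathbf{e}_G(t)\|_2\le\int_0^t e^{\|\mathbb{P}_G\|_2\,\kappa s}\,\big\|[\mathbf{I}-\mathbb{P}_G]\,\mathbf{R}(\mathbf{u}_F(t-s))\big\|_2\,ds,$$ $$\|\mathbf{e}_A(t)\|_2\le\int_0^t e^{\|\mathbb{P}_A\|_2\,\kappa s}\,\big\|[\mathbf{I}-\mathbb{P}_A]\,\mathbf{R}(\mathbf{u}_F(t-s))\big\|_2\,ds.$$
   Context: $N,K$ are positive integers with $K\le N$, and $T>0$. $\tilde{\mathbf{V}}\in\mathbb{R}^{N\times K}$ is a matrix with orthonormal columns (the coarse-scale trial basis), so $\tilde{\mathbf{V}}^T\tilde{\mathbf{V}}=\mathbf{I}$. The coarse-scale projector is $\tilde{\Pi}=\tilde{\mathbf{V}}\tilde{\mathbf{V}}^T$ and the fine-scale (orthogonal) projector is $\Pi'=\mathbf{I}-\tilde{\mathbf{V}}\tilde{\mathbf{V}}^T$. $\mathbf{J}[\mathbf{u}]=\frac{\partial\mathbf{R}}{\partial\mathbf{y}}(\mathbf{u})\in\mathbb{R}^{N\times N}$ is the Jacobian of $\mathbf{R}$ at $\mathbf{u}$. $\tau\ge 0$ is a fixed real constant (the memory length). Initial conditions are assumed to lie in the coarse-scale trial space: $\mathbf{u}_0\in\mathrm{Range}(\tilde{\mathbf{V}})$. $\|\cdot\|_2$ is the Euclidean norm for vectors and the induced operator norm for matrices. *)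

theory Defs
  imports "HOL-Analysis.Analysis"
begin

text \<open>A matrix with \<open>N = CARD('n)\<close> rows and \<open>K = CARD('k)\<close> columns has type \<open>real ^ 'k ^ 'n\<close>.
  The Jacobian matrix is the library constant \<^const>\<open>jacobian\<close>, and the norm of a matrix \<open>A\<close>
  induced by the Euclidean vector norm is \<open>onorm ((*v) A)\<close>.\<close>

definition orthonormal_columns :: "real ^ 'k ^ 'n \<Rightarrow> bool" where
  "orthonormal_columns V \<longleftrightarrow> transpose V ** V = mat 1"

definition coarse_proj :: "real ^ 'k ^ 'n \<Rightarrow> real ^ 'n ^ 'n" where
  "coarse_proj V = V ** transpose V"

definition fine_proj :: "real ^ 'k ^ 'n \<Rightarrow> real ^ 'n ^ 'n" where
  "fine_proj V = mat 1 - V ** transpose V"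

definition galerkin_proj :: "real ^ 'k ^ 'n \<Rightarrow> real ^ 'n ^ 'n" where
  "galerkin_proj V = coarse_proj V"

text \<open>The Adjoint Petrov--Galerkin matrix at the state \<open>u\<close>; \<open>\<tau>\<close> is the memory length. It is in
  general not idempotent, despite being called a projector.\<close>

definition apg_proj ::
  "real ^ 'k ^ 'n \<Rightarrow> real \<Rightarrow> (real ^ 'n \<Rightarrow> real ^ 'n) \<Rightarrow> real ^ 'n \<Rightarrow> real ^ 'n ^ 'n" where
  "apg_proj V \<tau> R u = coarse_proj V ** (mat 1 + \<tau> *\<^sub>R (jacobian R (at u) ** fine_proj V))"

definition C1_map :: "(real ^ 'n \<Rightarrow> real ^ 'n) \<Rightarrow> bool" where
  "C1_map R \<longleftrightarrow> (\<forall>x. R differentiable (at x)) \<and> continuous_on UNIV (\<lambda>x. jacobian R (at x))"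

text \<open>The derivative is taken within \<open>[0,T]\<close>, hence is one-sided at the two endpoints.\<close>

definition solves_ivp ::
  "(real ^ 'n \<Rightarrow> real ^ 'n) \<Rightarrow> real \<Rightarrow> real ^ 'n \<Rightarrow> (real \<Rightarrow> real ^ 'n) \<Rightarrow> bool" where
  "solves_ivp f T u0 u \<longleftrightarrow>
     u 0 = u0 \<and> (\<forall>t\<in>{0..T}. (u has_vector_derivative f (u t)) (at t within {0..T}))"

end

theory Submission
  imports Defs
begin

text \<open>
  Both reduced models have the form \<open>u' = P (R u)\<close> for a matrix \<open>P\<close> that is constant along the
  trajectory: for Galerkin by definition, for Adjoint Petrov--Galerkin by the stationarity
  hypothesis. Hence one estimate, \<open>projected_flow_error_bound\<close>, gives both inequalities.

  Splitting the derivative of the error \<open>e = uF - u\<close> as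
  \<open>e' = (I - P) R(uF) + P (R(uF) - R(u))\<close>
  separates the residual of the full-order solution from a term whose norm is at most
  \<open>\<parallel>P\<parallel> \<kappa> \<parallel>e\<parallel>\<close>. The norm of \<open>e\<close> need not be differentiable where \<open>e\<close> vanishes, so the
  inequality is integrated first, and Gronwall's lemma \<open>gronwall_integral\<close> is applied to
  \<open>\<parallel>e(t)\<parallel> \<le> \<integral>\<^sub>0\<^sup>t (residual + \<parallel>P\<parallel> \<kappa> \<parallel>e\<parallel>)\<close>. Gronwall's lemma yields the convolution of the
  residual with the exponential kernel; reflecting the integration variable moves the delay
  from the kernel to the residual.
\<close>

text \<open>
  The majorant \<open>v(t) = \<integral>\<^sub>0\<^sup>t (g + L a)\<close> is differentiable even if \<open>a\<close> is not, and \<open>a \<le> v\<close> turns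
  \<open>v' = g + L a\<close> into \<open>v' \<le> g + L v\<close>. The integrating factor then makes the derivative of
  \<open>exp (- L t) v(t)\<close> at most \<open>exp (- L t) g(t)\<close>.
\<close>

lemma gronwall_integral:
  fixes a g :: "real \<Rightarrow> real"
  assumes t: "0 \<le> t" and L: "0 \<le> L"
    and a: "continuous_on {0..t} a" and g: "continuous_on {0..t} g"
    and le: "\<And>s. s \<in> {0..t} \<Longrightarrow> a s \<le> integral {0..s} (\<lambda>r. g r + L * a r)"
  shows "a t \<le> integral {0..t} (\<lambda>s. exp (L * (t - s)) * g s)"
proof -
  define v where "v = (\<lambda>s. integral {0..s} (\<lambda>r. g r + L * a r))"
  have v_deriv: "(v has_real_derivative g s + L * a s) (at s within {0..t})"
    if "s \<in> {0..t}" for s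
    unfolding v_def
    by (rule integral_has_real_derivative) (use that in \<open>auto intro!: continuous_intros a g\<close>)
  have "((\<lambda>s. exp (- L * s) * v s) has_vector_derivative
          exp (- L * s) * (g s + L * (a s - v s))) (at s within {0..t})"
    if "s \<in> {0..t}" for s
    unfolding has_real_derivative_iff_has_vector_derivative[symmetric]
    by (auto intro!: derivative_eq_intros v_deriv that simp: algebra_simps)
  then have "((\<lambda>s. exp (- L * s) * (g s + L * (a s - v s))) has_integral
      exp (- L * t) * v t - exp (- L * 0) * v 0) {0..t}"
    by (intro fundamental_theorem_of_calculus t)
  moreover have "((\<lambda>s. exp (- L * s) * g s) has_integral
      integral {0..t} (\<lambda>s. exp (- L * s) * g s)) {0..t}"
    by (intro integrable_integral integrable_continuous_real continuous_intros g)
  moreover have "exp (- L * s) * (g s + L * (a s - v s)) \<le> exp (- L * s) * g s"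
    if "s \<in> {0..t}" for s
    using le[OF that] L by (simp add: v_def mult_nonneg_nonpos)
  ultimately have "exp (- L * t) * v t - exp (- L * 0) * v 0
      \<le> integral {0..t} (\<lambda>s. exp (- L * s) * g s)"
    by (rule has_integral_le)
  then have "exp (- L * t) * v t \<le> integral {0..t} (\<lambda>s. exp (- L * s) * g s)"
    by (simp add: v_def)
  then have "exp (L * t) * (exp (- L * t) * v t)
      \<le> exp (L * t) * integral {0..t} (\<lambda>s. exp (- L * s) * g s)"
    by (rule mult_left_mono) simp
  also have "exp (L * t) * (exp (- L * t) * v t) = v t"
    by (simp add: exp_minus)
  also have "exp (L * t) * integral {0..t} (\<lambda>s. exp (- L * s) * g s)
      = integral {0..t} (\<lambda>s. exp (L * (t - s)) * g s)"
    by (simp add: right_diff_distrib exp_diff exp_minus divide_inverse mult_ac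
        flip: integral_mult_right)
  finally show ?thesis
    using le[of t] t by (simp add: v_def)
qed

lemma integral_reflect_interval:
  fixes f :: "real \<Rightarrow> 'a :: euclidean_space"
  assumes "continuous_on {0..t} f"
  shows "integral {0..t} (\<lambda>s. f (t - s)) = integral {0..t} f"
proof (cases "0 \<le> t")
  case True
  have "(f has_integral integral {0..t} f) (cbox 0 t)"
    using assms by (simp add: integrable_continuous_real integrable_integral)
  from has_integral_affinity[OF this, of "-1" t]
  have "((\<lambda>s. f (t - s)) has_integral integral {0..t} f) {0..t}"
    using True by (simp add: image_image)
  then show ?thesis
    by (rule integral_unique)
qed simp

text \<open>
  Stated for an arbitrary bounded linear \<open>P\<close>, so that it covers the Adjoint Petrov--Galerkin
  matrix, which is in general not idempotent. The residual is evaluated along the unprojected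
  solution \<open>w\<close> because the derivative of \<open>w - u\<close> is split by adding and subtracting \<open>P (R w)\<close>.
\<close>

lemma projected_flow_error_bound:
  fixes R P :: "'a :: euclidean_space \<Rightarrow> 'a"
  assumes t: "t \<in> {0..T}"
    and P: "bounded_linear P"
    and lip: "\<kappa>-lipschitz_on UNIV R"
    and w: "\<And>s. s \<in> {0..T} \<Longrightarrow> (w has_vector_derivative R (w s)) (at s within {0..T})"
    and u: "\<And>s. s \<in> {0..T} \<Longrightarrow> (u has_vector_derivative P (R (u s))) (at s within {0..T})"
    and init: "w 0 = u 0"
  shows "norm (w t - u t)
    \<le> integral {0..t} (\<lambda>s. exp (onorm P * \<kappa> * s) * norm (R (w (t - s)) - P (R (w (t - s)))))"
proof -
  interpret P: bounded_linear P by (rule P)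
  define L where "L = onorm P * \<kappa>"
  define g where "g = (\<lambda>s. norm (R (w s) - P (R (w s))))"
  have L: "0 \<le> L"
    unfolding L_def using onorm_pos_le[OF P] lipschitz_on_nonneg[OF lip] by simp
  have sub: "{0..t} \<subseteq> {0..T}" using t by auto
  have cont_w: "continuous_on {0..t} w" and cont_u: "continuous_on {0..t} u"
    using continuous_on_subset[OF continuous_on_vector_derivative[OF w] sub]
      continuous_on_subset[OF continuous_on_vector_derivative[OF u] sub] by auto
  have cont_Rw: "continuous_on {0..t} (\<lambda>s. R (w s))"
    by (rule continuous_on_compose2[OF lipschitz_on_continuous_on[OF lip] cont_w]) simp
  have cont_g: "continuous_on {0..t} g"
    unfolding g_def by (intro continuous_intros cont_Rw P.continuous_on)
  have cont_e: "continuous_on {0..t} (\<lambda>s. norm (w s - u s))"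
    by (intro continuous_intros cont_w cont_u)
  have "norm (w s - u s) \<le> integral {0..s} (\<lambda>r. g r + L * norm (w r - u r))"
    if s: "s \<in> {0..t}" for s
  proof -
    have "((\<lambda>r. w r - u r) has_vector_derivative R (w r) - P (R (u r))) (at r within {0..s})"
      if "r \<in> {0..s}" for r
      by (rule has_vector_derivative_within_subset[of _ _ _ "{0..T}"])
        (use that s t in \<open>auto intro!: has_vector_derivative_diff w u\<close>)
    then have int: "((\<lambda>r. R (w r) - P (R (u r))) has_integral (w s - u s) - (w 0 - u 0)) {0..s}"
      using s by (intro fundamental_theorem_of_calculus) auto
    have bound: "norm (R (w r) - P (R (u r))) \<le> g r + L * norm (w r - u r)" for r
    proof -
      have "R (w r) - P (R (u r)) = (R (w r) - P (R (w r))) + P (R (w r) - R (u r))"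
        by (simp add: P.diff)
      then have "norm (R (w r) - P (R (u r))) \<le> g r + norm (P (R (w r) - R (u r)))"
        unfolding g_def by (metis norm_triangle_ineq)
      also have "norm (P (R (w r) - R (u r))) \<le> onorm P * norm (R (w r) - R (u r))"
        by (rule onorm[OF P])
      also have "\<dots> \<le> onorm P * (\<kappa> * norm (w r - u r))"
        using lipschitz_onD[OF lip, of "w r" "u r"] onorm_pos_le[OF P]
        by (intro mult_left_mono) (auto simp: dist_norm)
      finally show ?thesis by (simp add: L_def mult.assoc)
    qed
    have "norm (integral {0..s} (\<lambda>r. R (w r) - P (R (u r))))
        \<le> integral {0..s} (\<lambda>r. g r + L * norm (w r - u r))"
    proof (rule integral_norm_bound_integral)
      show "(\<lambda>r. g r + L * norm (w r - u r)) integrable_on {0..s}"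
        using s by (intro integrable_continuous_real continuous_intros
            continuous_on_subset[OF cont_g] continuous_on_subset[OF cont_w]
            continuous_on_subset[OF cont_u]) auto
    qed (use int bound in auto)
    then show ?thesis
      using init integral_unique[OF int] by simp
  qed
  then have "norm (w t - u t) \<le> integral {0..t} (\<lambda>s. exp (L * (t - s)) * g s)"
    using t L cont_e cont_g by (intro gronwall_integral) auto
  also have "\<dots> = integral {0..t} (\<lambda>s. exp (L * (t - (t - s))) * g (t - s))"
    by (rule integral_reflect_interval[symmetric]) (intro continuous_intros cont_g)
  finally show ?thesis
    by (simp add: L_def g_def)
qed


theorem theorem1:
  fixes R :: "real ^ 'n \<Rightarrow> real ^ 'n"
    and V :: "real ^ 'k ^ 'n"
    and \<kappa> \<tau> T :: real
    and u0 :: "real ^ 'n"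
    and uF uG uA :: "real \<Rightarrow> real ^ 'n"
    and PG PA :: "real ^ 'n ^ 'n"
    and eG eA :: "real \<Rightarrow> real ^ 'n"
  assumes K_le_N: "CARD('k) \<le> CARD('n)"
    and T_pos: "T > 0"
    and tau_nonneg: "\<tau> \<ge> 0"
    and V: "orthonormal_columns V"
    and R_C1: "C1_map R"
    and kappa_pos: "\<kappa> > 0"
    and R_lipschitz: "\<And>x y. norm (R x - R y) \<le> \<kappa> * norm (x - y)"
    and u0: "u0 \<in> range ((*v) V)"
    and full_order: "solves_ivp R T u0 uF"
    and galerkin: "solves_ivp (\<lambda>x. galerkin_proj V *v R x) T u0 uG"
    and apg: "solves_ivp (\<lambda>x. apg_proj V \<tau> R x *v R x) T u0 uA"
    and PG: "PG = galerkin_proj V"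
    and PA_stationary: "\<And>t. t \<in> {0..T} \<Longrightarrow> apg_proj V \<tau> R (uA t) = PA"
    and eG: "eG = (\<lambda>t. uF t - uG t)"
    and eA: "eA = (\<lambda>t. uF t - uA t)"
  shows "\<forall>t\<in>{0..T}.
      norm (eG t) \<le> integral {0..t}
        (\<lambda>s. exp (onorm ((*v) PG) * \<kappa> * s) * norm ((mat 1 - PG) *v R (uF (t - s)))) \<and>
      norm (eA t) \<le> integral {0..t}
        (\<lambda>s. exp (onorm ((*v) PA) * \<kappa> * s) * norm ((mat 1 - PA) *v R (uF (t - s))))"
proof
  fix t assume t: "t \<in> {0..T}"
  have lip: "\<kappa>-lipschitz_on UNIV R"
    using R_lipschitz kappa_pos by (auto simp: lipschitz_on_def dist_norm)
  have w: "(uF has_vector_derivative R (uF s)) (at s within {0..T})" if "s \<in> {0..T}" for s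
    using full_order that by (simp add: solves_ivp_def)
  have bound: "norm (uF t - u t) \<le> integral {0..t}
        (\<lambda>s. exp (onorm ((*v) P) * \<kappa> * s) * norm ((mat 1 - P) *v R (uF (t - s))))"
    if "u 0 = u0"
      "\<And>s. s \<in> {0..T} \<Longrightarrow> (u has_vector_derivative P *v R (u s)) (at s within {0..T})"
    for u and P :: "real ^ 'n ^ 'n"
    using projected_flow_error_bound[of t T "(*v) P" \<kappa> R uF u] t lip w that full_order
    by (simp add: solves_ivp_def matrix_vector_mult_diff_rdistrib)
  have "norm (eG t) \<le> integral {0..t}
        (\<lambda>s. exp (onorm ((*v) PG) * \<kappa> * s) * norm ((mat 1 - PG) *v R (uF (t - s))))"
    unfolding eG by (rule bound) (use galerkin PG in \<open>auto simp: solves_ivp_def\<close>)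
  moreover have "norm (eA t) \<le> integral {0..t}
        (\<lambda>s. exp (onorm ((*v) PA) * \<kappa> * s) * norm ((mat 1 - PA) *v R (uF (t - s))))"
    unfolding eA
  proof (rule bound)
    show "(uA has_vector_derivative PA *v R (uA s)) (at s within {0..T})" if "s \<in> {0..T}" for s
      using apg that PA_stationary[OF that] unfolding solves_ivp_def by metis
  qed (use apg in \<open>simp add: solves_ivp_def\<close>)
  ultimately show "norm (eG t) \<le> integral {0..t}
        (\<lambda>s. exp (onorm ((*v) PG) * \<kappa> * s) * norm ((mat 1 - PG) *v R (uF (t - s)))) \<and>
      norm (eA t) \<le> integral {0..t}
        (\<lambda>s. exp (onorm ((*v) PA) * \<kappa> * s) * norm ((mat 1 - PA) *v R (uF (t - s))))"
    by blast
qed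

end
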